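(* Let $G$ be a finite connected undirected weighted graph with $N$ vertices and graph Laplacian $\mathcal{L}$, and let $g$ be an SGWT kernel. If $g$ satisfies the admissibility condition $$\int_0^{\infty} \frac{g^2(x)}{x}\,dx = C_g < \infty ,$$ and $g(0)=0$, then for every $f\in\mathbb{R}^N$ and every vertex $m$, $$\frac{1}{C_g}\sum_{n=1}^N \int_0^{\infty} W_f(t,n)\,\psi_{t,n}(m)\,\frac{dt}{t} = f^{\#}(m),$$ where $f^{\#} = f-\langle \chi_0, f\rangle \chi_0$. In particular, the complete reconstruction is then given by $f = f^{\#}+\hat f(0)\chi_0$.
   Context: A finite weighted undirected graph $G$ on vertices $1,\dots,N$ is given by a symmetric matrix $A=(a_{m,n})$ with non-negative entries, $a_{m,n}>0$ being the weight of the edge connecting $m$ and $n$ and $a_{m,n}=0$ if there is no such edge (loops are allowed). Functions on the vertices are identified with vectors in $\mathbb{R}^N$. The degree of $m$ is $d(m)=\sum_n a_{m,n}$, $D$ is the diagonal matrix of degrees, and the (non-normalized) graph Laplacian is $\mathcal{L}=D-A$. Since $\mathcal{L}$ is real symmetric and positive semidefinite and $G$ is connected, fix an orthonormal basis of eigenvectors $\chi_0,\dots,\chi_{N-1}$ with $\mathcal{L}\chi_\ell=\lambda_\ell\chi_\ell$ and $0=\lambda_0<\lambda_1\le\dots\le\lambda_{N-1}$. The graph Fourier transform of $f$ is $\hat f(\ell)=\langle\chi_\ell,f\rangle=\sum_{n}\chi_\ell^*(n)f(n)$. An SGWT kernel is a function $g:[0,\infty)\to[0,\infty)$ that behaves as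 a band-pass filter, i.e. $g(0)=0$ and $\lim_{x\to\infty}g(x)=0$. For $t>0$, the wavelet operator is $T_g^t=g(t\mathcal{L})$, i.e. $(T_g^tf)(m)=\sum_{\ell=0}^{N-1}g(t\lambda_\ell)\hat f(\ell)\chi_\ell(m)$. The wavelet at scale $t$ centered at vertex $n$ is $\psi_{t,n}=T_g^t\delta_n$ (with $\delta_n$ the indicator vector of vertex $n$), i.e. $\psi_{t,n}(m)=\sum_{\ell=0}^{N-1}g(t\lambda_\ell)\chi_\ell^*(n)\chi_\ell(m)$, and the wavelet coefficients of $f$ are $W_f(t,n)=\langle\psi_{t,n},f\rangle=(T_g^tf)(n)$. *)

theory Defs
  imports "HOL-Analysis.Analysis"
begin

text \<open>The vertex set is a finite type \<open>'n\<close>, so that the number of vertices is \<open>N = CARD('n)\<close>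
  and functions on the vertices are vectors in \<open>real ^ 'n\<close>.  A graph is given by its weight
  matrix; a positive diagonal entry is a loop.\<close>

definition weighted_graph :: "real ^ 'n ^ 'n \<Rightarrow> bool" where
  "weighted_graph A \<longleftrightarrow> (\<forall>m n. A $ m $ n = A $ n $ m) \<and> (\<forall>m n. 0 \<le> A $ m $ n)"

definition connected_graph :: "real ^ 'n ^ 'n \<Rightarrow> bool" where
  "connected_graph A \<longleftrightarrow> (\<forall>m n. (m, n) \<in> {(i, j). A $ i $ j > 0}\<^sup>*)"

definition vdegree :: "real ^ 'n ^ 'n \<Rightarrow> 'n::finite \<Rightarrow> real" where
  "vdegree A m = (\<Sum>n\<in>UNIV. A $ m $ n)"

definition degree_matrix :: "real ^ 'n ^ 'n \<Rightarrow> real ^ 'n ^ 'n::finite" where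
  "degree_matrix A = (\<chi> m n. if m = n then vdegree A m else 0)"

definition laplacian :: "real ^ 'n ^ 'n \<Rightarrow> real ^ 'n ^ 'n::finite" where
  "laplacian A = degree_matrix A - A"

text \<open>Only the values of \<open>X\<close> (the eigenvectors) and \<open>ev\<close> (the eigenvalues) at indices below
  \<open>CARD('n)\<close> are relevant.  The relations \<open>ev 0 = 0\<close> and \<open>0 < ev 1\<close> (if there is more than one
  vertex) are not required here: they follow from the ordering of the eigenvalues when the
  graph is connected.\<close>

definition laplacian_eigenbasis ::
  "real ^ 'n ^ 'n \<Rightarrow> (nat \<Rightarrow> real ^ 'n::finite) \<Rightarrow> (nat \<Rightarrow> real) \<Rightarrow> bool" where
  "laplacian_eigenbasis A X ev \<longleftrightarrow>
     (\<forall>k<CARD('n). \<forall>l<CARD('n). X k \<bullet> X l = (if k = l then 1 else 0)) \<and>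
     span (X ` {..<CARD('n)}) = UNIV \<and>
     (\<forall>l<CARD('n). laplacian A *v X l = ev l *\<^sub>R X l) \<and>
     (\<forall>k l. k \<le> l \<longrightarrow> l < CARD('n) \<longrightarrow> ev k \<le> ev l)"

definition graph_fourier :: "(nat \<Rightarrow> real ^ 'n) \<Rightarrow> real ^ 'n \<Rightarrow> nat \<Rightarrow> real" where
  "graph_fourier X f l = X l \<bullet> f"

text \<open>Kernels are functions on \<open>[0, \<infinity>)\<close>; the values at negative arguments are irrelevant.\<close>

definition sgwt_kernel :: "(real \<Rightarrow> real) \<Rightarrow> bool" where
  "sgwt_kernel g \<longleftrightarrow> (\<forall>x\<ge>0. 0 \<le> g x) \<and> g 0 = 0 \<and> (g \<longlongrightarrow> 0) at_top"

definition admissible :: "(real \<Rightarrow> real) \<Rightarrow> bool" where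
  "admissible g \<longleftrightarrow> set_integrable lebesgue {0<..} (\<lambda>x. (g x)\<^sup>2 / x)"

definition admissibility_const :: "(real \<Rightarrow> real) \<Rightarrow> real" where
  "admissibility_const g = (LINT x:{0<..}|lebesgue. (g x)\<^sup>2 / x)"

definition wavelet_op ::
  "(nat \<Rightarrow> real ^ 'n) \<Rightarrow> (nat \<Rightarrow> real) \<Rightarrow> (real \<Rightarrow> real) \<Rightarrow> real \<Rightarrow> real ^ 'n \<Rightarrow> real ^ 'n::finite"
where
  "wavelet_op X ev g t f =
     (\<Sum>l<CARD('n). (g (t * ev l) * graph_fourier X f l) *\<^sub>R X l)"

definition wavelet ::
  "(nat \<Rightarrow> real ^ 'n) \<Rightarrow> (nat \<Rightarrow> real) \<Rightarrow> (real \<Rightarrow> real) \<Rightarrow> real \<Rightarrow> 'n \<Rightarrow> real ^ 'n::finite"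
where
  "wavelet X ev g t n = wavelet_op X ev g t (axis n 1)"

definition wavelet_coeff ::
  "(nat \<Rightarrow> real ^ 'n) \<Rightarrow> (nat \<Rightarrow> real) \<Rightarrow> (real \<Rightarrow> real) \<Rightarrow> real ^ 'n \<Rightarrow> real \<Rightarrow> 'n::finite \<Rightarrow> real"
where
  "wavelet_coeff X ev g f t n = wavelet X ev g t n \<bullet> f"

definition f_sharp :: "(nat \<Rightarrow> real ^ 'n) \<Rightarrow> real ^ 'n \<Rightarrow> real ^ 'n" where
  "f_sharp X f = f - (X 0 \<bullet> f) *\<^sub>R X 0"

lemma wavelet_nth:
  fixes X :: "nat \<Rightarrow> real ^ 'n"
  shows "wavelet X ev g t n $ m = (\<Sum>l<CARD('n). g (t * ev l) * X l $ n * X l $ m)"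
  by (simp add: wavelet_def wavelet_op_def graph_fourier_def inner_axis)

lemma wavelet_coeff_eq_wavelet_op:
  fixes X :: "nat \<Rightarrow> real ^ 'n"
  shows "wavelet_coeff X ev g f t n = wavelet_op X ev g t f $ n"
  unfolding wavelet_coeff_def wavelet_def wavelet_op_def graph_fourier_def
  by (simp add: inner_axis inner_sum_left mult_ac)

end

theory Submission
  imports Defs
begin

text \<open>The reconstruction formula is the spectral form of Calderon's identity.  In the
  eigenbasis, the integrand for the vertex \<open>n\<close> is a finite combination of the cross terms
  \<open>g (t * ev l) * g (t * ev k) / t\<close>, with coefficients containing
  \<open>X l $ n * X k $ n\<close>.  Summing over all vertices \<open>n\<close> turns this factor into the inner product
  \<open>X l \<bullet> X k\<close>, so that only the diagonal terms \<open>l = k\<close> survive.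

  The measure \<open>dt / t\<close> on the positive half-line is invariant under dilations
  (\<open>dilation_invariance\<close>).  Hence for a positive eigenvalue the diagonal term integrates to
  the admissibility constant, whatever the eigenvalue is, whereas for the eigenvalue
  zero it vanishes because \<open>g 0 = 0\<close>.  A connected graph has the eigenvalue zero exactly once, at the
  index \<open>0\<close> (\<open>first_eigenvalue_zero\<close>, \<open>later_eigenvalues_pos\<close>), so dividing by the
  constant yields the eigenvector expansion of \<open>f\<close> without its first term, which is
  \<open>f_sharp X f\<close>.

  The off-diagonal terms disappear only after summation, so their integrals have to exist
  one by one; this follows from the diagonal case and the inequality between geometric and arithmetic
  means (\<open>cross_term_integrable\<close>).\<close>

section \<open>The spectrum of the Laplacian of a connected graph\<close>

lemma laplacian_mult_nth:
  fixes A :: "real ^ 'n ^ 'n"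
  shows "(laplacian A *v x) $ m = (\<Sum>n\<in>UNIV. A $ m $ n * (x $ m - x $ n))"
proof -
  have "(laplacian A *v x) $ m
      = (\<Sum>n\<in>UNIV. (if m = n then vdegree A m * x $ n else 0)) - (\<Sum>n\<in>UNIV. A $ m $ n * x $ n)"
    unfolding laplacian_def degree_matrix_def matrix_vector_mult_def
    by (simp add: left_diff_distrib sum_subtractf if_distrib[where f="\<lambda>u. u * _"] cong: if_cong)
  also have "\<dots> = vdegree A m * x $ m - (\<Sum>n\<in>UNIV. A $ m $ n * x $ n)"
    by simp
  also have "\<dots> = (\<Sum>n\<in>UNIV. A $ m $ n * (x $ m - x $ n))"
    unfolding vdegree_def by (simp add: sum_distrib_right right_diff_distrib sum_subtractf)
  finally show ?thesis .
qed

text \<open>Exchanging the two summation indices and using the symmetry of the weights turns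
  \<open>x m * (x m - x n)\<close> into \<open>- x n * (x m - x n)\<close>; the average of the two is half a square.\<close>

lemma laplacian_quadratic_form:
  fixes A :: "real ^ 'n ^ 'n"
  assumes "weighted_graph A"
  shows "2 * (x \<bullet> (laplacian A *v x)) = (\<Sum>m\<in>UNIV. \<Sum>n\<in>UNIV. A $ m $ n * (x $ m - x $ n)\<^sup>2)"
proof -
  have sym: "A $ m $ n = A $ n $ m" for m n
    using assms by (simp add: weighted_graph_def)
  have 1: "x \<bullet> (laplacian A *v x) = (\<Sum>m\<in>UNIV. \<Sum>n\<in>UNIV. A $ m $ n * (x $ m * (x $ m - x $ n)))"
    unfolding inner_vec_def by (simp add: laplacian_mult_nth sum_distrib_left mult_ac)
  also have "\<dots> = (\<Sum>n\<in>UNIV. \<Sum>m\<in>UNIV. A $ m $ n * (x $ m * (x $ m - x $ n)))"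
    by (rule sum.swap)
  also have "\<dots> = (\<Sum>m\<in>UNIV. \<Sum>n\<in>UNIV. A $ m $ n * (x $ n * (x $ n - x $ m)))"
    by (subst sym) simp
  finally have 2: "x \<bullet> (laplacian A *v x)
      = (\<Sum>m\<in>UNIV. \<Sum>n\<in>UNIV. A $ m $ n * (x $ n * (x $ n - x $ m)))" .
  have "2 * (x \<bullet> (laplacian A *v x))
      = (\<Sum>m\<in>UNIV. \<Sum>n\<in>UNIV. A $ m $ n * (x $ m * (x $ m - x $ n)) + A $ m $ n * (x $ n * (x $ n - x $ m)))"
    unfolding sum.distrib using 1 2 by simp
  then show ?thesis
    by (simp add: power2_eq_square algebra_simps)
qed

lemma laplacian_quadratic_form_nonneg:
  fixes A :: "real ^ 'n ^ 'n"
  assumes "weighted_graph A"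
  shows "0 \<le> x \<bullet> (laplacian A *v x)"
proof -
  have "0 \<le> (\<Sum>m\<in>UNIV. \<Sum>n\<in>UNIV. A $ m $ n * (x $ m - x $ n)\<^sup>2)"
    using assms by (intro sum_nonneg mult_nonneg_nonneg) (auto simp: weighted_graph_def)
  then show ?thesis
    using laplacian_quadratic_form[OF assms, of x] by linarith
qed

text \<open>A sum of non-negative terms vanishes only if each term does; so \<open>x\<close> takes the same value at
  both ends of every edge, hence along every path.\<close>

lemma laplacian_kernel_constant:
  fixes A :: "real ^ 'n ^ 'n"
  assumes "weighted_graph A" and "connected_graph A" and "laplacian A *v x = 0"
  shows "x $ m = x $ n"
proof -
  have nonneg: "0 \<le> A $ i $ j * (x $ i - x $ j)\<^sup>2" for i j
    using assms(1) by (simp add: weighted_graph_def)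
  have "(\<Sum>i\<in>UNIV. \<Sum>j\<in>UNIV. A $ i $ j * (x $ i - x $ j)\<^sup>2) = 0"
    using laplacian_quadratic_form[OF assms(1), of x] assms(3) by simp
  then have zero: "A $ i $ j * (x $ i - x $ j)\<^sup>2 = 0" for i j
    using nonneg by (simp add: sum_nonneg_eq_0_iff sum_nonneg)
  have edge: "x $ i = x $ j" if "A $ i $ j > 0" for i j
    using zero[of i j] that by simp
  have "(m, n) \<in> {(i, j). A $ i $ j > 0}\<^sup>*"
    using assms(2) by (simp add: connected_graph_def)
  then show ?thesis
    by (induction rule: rtrancl_induct) (auto dest: edge)
qed

lemma eigenbasis_expansion:
  fixes A :: "real ^ 'n ^ 'n"
  assumes "laplacian_eigenbasis A X ev"
  shows "f = (\<Sum>l<CARD('n). graph_fourier X f l *\<^sub>R X l)"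
proof -
  define d where "d = f - (\<Sum>l<CARD('n). graph_fourier X f l *\<^sub>R X l)"
  have on: "X k \<bullet> X l = (if k = l then 1 else 0)" if "k < CARD('n)" "l < CARD('n)" for k l
    using assms that by (simp add: laplacian_eigenbasis_def)
  have "orthogonal d y" if y: "y \<in> X ` {..<CARD('n)}" for y
  proof -
    obtain k where k: "k < CARD('n)" "y = X k"
      using y by auto
    have "X k \<bullet> (\<Sum>l<CARD('n). graph_fourier X f l *\<^sub>R X l)
        = (\<Sum>l<CARD('n). if k = l then graph_fourier X f l else 0)"
      unfolding inner_sum_right using k by (intro sum.cong) (auto simp: on)
    also have "\<dots> = X k \<bullet> f"
      using k by (simp add: graph_fourier_def)
    finally show ?thesis
      by (simp add: d_def orthogonal_def k inner_diff_left inner_diff_right inner_commute)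
  qed
  moreover have "d \<in> span (X ` {..<CARD('n)})"
    using assms by (simp add: laplacian_eigenbasis_def)
  ultimately have "orthogonal d d"
    by (rule orthogonal_to_span[rotated])
  then show ?thesis
    by (simp add: d_def orthogonal_self)
qed

lemma eigenvalue_eq_quadratic_form:
  fixes A :: "real ^ 'n ^ 'n"
  assumes "laplacian_eigenbasis A X ev" and "l < CARD('n)"
  shows "ev l = X l \<bullet> (laplacian A *v X l)"
  using assms by (simp add: laplacian_eigenbasis_def)

text \<open>The constant vector is in the kernel of the symmetric matrix \<open>laplacian A\<close> and thus
  orthogonal to every eigenvector of a nonzero eigenvalue.  If the smallest eigenvalue were
  positive, this nonzero vector would be orthogonal to the whole basis.\<close>

lemma first_eigenvalue_zero:
  fixes A :: "real ^ 'n ^ 'n"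
  assumes G: "weighted_graph A" and B: "laplacian_eigenbasis A X ev"
  shows "ev 0 = 0"
proof (rule ccontr)
  assume "ev 0 \<noteq> 0"
  moreover have "0 \<le> ev 0"
    using laplacian_quadratic_form_nonneg[OF G] eigenvalue_eq_quadratic_form[OF B, of 0] by simp
  ultimately have pos: "0 < ev l" if "l < CARD('n)" for l
    using B that unfolding laplacian_eigenbasis_def by (smt (verit) le0)
  define u :: "real ^ 'n" where "u = (\<chi> i. 1)"
  have u_orthogonal_range: "u \<bullet> (laplacian A *v x) = 0" for x
  proof -
    have sym: "A $ m $ n = A $ n $ m" for m n
      using G by (simp add: weighted_graph_def)
    have "u \<bullet> (laplacian A *v x)
        = (\<Sum>m\<in>UNIV. \<Sum>n\<in>UNIV. A $ m $ n * x $ m) - (\<Sum>m\<in>UNIV. \<Sum>n\<in>UNIV. A $ m $ n * x $ n)"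
      by (simp add: inner_vec_def u_def laplacian_mult_nth right_diff_distrib sum_subtractf)
    also have "(\<Sum>m\<in>UNIV. \<Sum>n\<in>UNIV. A $ m $ n * x $ n) = (\<Sum>n\<in>UNIV. \<Sum>m\<in>UNIV. A $ n $ m * x $ n)"
      by (subst sum.swap, subst sym) simp
    finally show ?thesis by simp
  qed
  have "graph_fourier X u l = 0" if "l < CARD('n)" for l
  proof -
    have "laplacian A *v X l = ev l *\<^sub>R X l"
      using B that by (simp add: laplacian_eigenbasis_def)
    then have "ev l * (u \<bullet> X l) = 0"
      using u_orthogonal_range[of "X l"] by simp
    then show ?thesis
      using pos[OF that] by (simp add: graph_fourier_def inner_commute)
  qed
  then have "u = 0"
    using eigenbasis_expansion[OF B, of u] by simp
  then show False
    by (simp add: u_def vec_eq_iff)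
qed

text \<open>Two eigenvectors of the eigenvalue zero are both constant, so the squared inner product of the
  unit vectors \<open>X 0\<close> and \<open>X l\<close> would be \<open>1\<close> and not \<open>0\<close>.\<close>

lemma later_eigenvalues_pos:
  fixes A :: "real ^ 'n ^ 'n"
  assumes G: "weighted_graph A" and C: "connected_graph A" and B: "laplacian_eigenbasis A X ev"
    and l: "l < CARD('n)" "l \<noteq> 0"
  shows "0 < ev l"
proof (rule ccontr)
  assume "\<not> 0 < ev l"
  moreover have "0 \<le> ev l"
    using laplacian_quadratic_form_nonneg[OF G] eigenvalue_eq_quadratic_form[OF B l(1)] by simp
  ultimately have "ev l = 0" by simp
  have eig: "laplacian A *v X k = ev k *\<^sub>R X k" if "k < CARD('n)" for k
    using B that by (simp add: laplacian_eigenbasis_def)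
  have "laplacian A *v X 0 = 0" "laplacian A *v X l = 0"
    using eig[of 0] eig[OF l(1)] first_eigenvalue_zero[OF G B] \<open>ev l = 0\<close> by simp_all
  note const = this[THEN laplacian_kernel_constant[OF G C]]
  fix i :: 'n
  define a where "a = X 0 $ i"
  define b where "b = X l $ i"
  have X: "X 0 = (\<chi> m. a)" "X l = (\<chi> m. b)"
    using const[of _ i] by (simp_all add: vec_eq_iff a_def b_def)
  have "X 0 \<bullet> X 0 = 1" "X l \<bullet> X l = 1" "X 0 \<bullet> X l = 0"
    using B l by (simp_all add: laplacian_eigenbasis_def)
  then show False
    unfolding X by (auto simp: inner_vec_def)
qed

section \<open>Integration against the dilation-invariant measure\<close>

lemma dilation_invariance:
  fixes F :: "real \<Rightarrow> real"
  assumes int: "set_integrable lebesgue {0<..} (\<lambda>x. F x / x)" and c: "0 < c"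
  shows "set_integrable lebesgue {0<..} (\<lambda>t. F (t * c) / t)"
    and "(LINT t:{0<..}|lebesgue. F (t * c) / t) = (LINT x:{0<..}|lebesgue. F x / x)"
proof -
  define h where "h x = indicator {0<..} x *\<^sub>R (F x / x)" for x
  define L where "L = distr lebesgue lebesgue (\<lambda>x::real. c * x)"
  have lebesgue_eq: "lebesgue = density L (\<lambda>x. ennreal c)"
    using lebesgue_real_scale[of c] c by (simp add: L_def)
  have meas: "(\<lambda>x::real. c * x) \<in> lebesgue \<rightarrow>\<^sub>M lebesgue"
    using lebesgue_measurable_scaling[where ?'a=real, of c]
    by (rule back_subst[where P="\<lambda>u. u \<in> lebesgue \<rightarrow>\<^sub>M lebesgue"]) (simp add: fun_eq_iff)
  have hi: "integrable lebesgue h"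
    using int by (simp add: h_def[abs_def] set_integrable_def)
  then have hm: "h \<in> borel_measurable lebesgue"
    by simp
  then have hL: "h \<in> borel_measurable L"
    by (simp add: L_def)
  \<comment> \<open>The Jacobian \<open>c\<close> of the substitution cancels against the \<open>c\<close> in \<open>dx / x\<close>.\<close>
  have scaled: "c * h (c * t) = indicator {0<..} t *\<^sub>R (F (t * c) / t)" for t
    using c by (simp add: h_def indicator_def zero_less_mult_iff mult.commute)
  have "integrable (density L (\<lambda>x. ennreal c)) h"
    using hi lebesgue_eq by simp
  then have "integrable L (\<lambda>x. c * h x)"
    using integrable_density[OF hL, of "\<lambda>_. c"] c by simp
  then have "integrable lebesgue (\<lambda>t. c * h (c * t))"
    unfolding L_def using hm by (subst (asm) integrable_distr_eq[OF meas]) simp_all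
  then show "set_integrable lebesgue {0<..} (\<lambda>t. F (t * c) / t)"
    by (simp add: set_integrable_def scaled)
  have "integral\<^sup>L lebesgue h = integral\<^sup>L (density L (\<lambda>x. ennreal c)) h"
    using lebesgue_eq by simp
  also have "\<dots> = integral\<^sup>L L (\<lambda>x. c * h x)"
    using integral_density[OF hL, of "\<lambda>_. c"] c by simp
  also have "\<dots> = integral\<^sup>L lebesgue (\<lambda>t. c * h (c * t))"
    unfolding L_def using hm by (intro integral_distr[OF meas]) simp
  finally show "(LINT t:{0<..}|lebesgue. F (t * c) / t) = (LINT x:{0<..}|lebesgue. F x / x)"
    unfolding set_lebesgue_integral_def scaled[symmetric] h_def[symmetric] by (rule sym)
qed

text \<open>Admissibility asserts measurability of \<open>(g x)\<^sup>2 / x\<close> only.  Since \<open>g\<close> is non-negative, it is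
  recovered as a square root; this is what makes products of two different dilates measurable.\<close>

lemma dilated_kernel_measurable:
  assumes nonneg: "\<And>x. 0 \<le> x \<Longrightarrow> 0 \<le> g x" and int: "admissible g" and c: "0 < c"
  shows "(\<lambda>t. indicator {0<..} t * g (t * c)) \<in> borel_measurable lebesgue"
proof -
  have "set_integrable lebesgue {0<..} (\<lambda>t. (g (t * c))\<^sup>2 / t)"
    using dilation_invariance(1)[of "\<lambda>x. (g x)\<^sup>2"] int c by (simp add: admissible_def)
  then have [measurable]: "(\<lambda>t. indicator {0<..} t *\<^sub>R ((g (t * c))\<^sup>2 / t)) \<in> borel_measurable lebesgue"
    unfolding set_integrable_def by (rule borel_measurable_integrable)
  have [measurable]: "(\<lambda>t::real. t) \<in> borel_measurable lebesgue"
    by (rule measurable_completion) simp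
  have "(\<lambda>t. sqrt (t * (indicator {0<..} t *\<^sub>R ((g (t * c))\<^sup>2 / t)))) \<in> borel_measurable lebesgue"
    by measurable
  also have "(\<lambda>t. sqrt (t * (indicator {0<..} t *\<^sub>R ((g (t * c))\<^sup>2 / t))))
      = (\<lambda>t. indicator {0<..} t * g (t * c))"
    using nonneg c by (auto simp: fun_eq_iff indicator_def)
  finally show ?thesis .
qed

lemma cross_term_integrable:
  assumes K: "sgwt_kernel g" and int: "admissible g" and ab: "0 \<le> a" "0 \<le> b"
  shows "set_integrable lebesgue {0<..} (\<lambda>t. g (t * a) * g (t * b) / t)"
proof (cases "a = 0 \<or> b = 0")
  case True
  moreover have "g 0 = 0"
    using K by (simp add: sgwt_kernel_def)
  ultimately have "(\<lambda>t. g (t * a) * g (t * b) / t) = (\<lambda>t. 0)"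
    by auto
  then show ?thesis
    by (simp add: set_integrable_def)
next
  case False
  then have pos: "0 < a" "0 < b"
    using ab by auto
  have nonneg: "0 \<le> g x" if "0 \<le> x" for x
    using K that by (simp add: sgwt_kernel_def)
  have sq: "set_integrable lebesgue {0<..} (\<lambda>t. (g (t * c))\<^sup>2 / t)" if "0 < c" for c
    using dilation_invariance(1)[of "\<lambda>x. (g x)\<^sup>2"] int that by (simp add: admissible_def)
  show ?thesis
  proof (rule set_integrable_bound)
    show "set_integrable lebesgue {0<..} (\<lambda>t. (g (t * a))\<^sup>2 / t + (g (t * b))\<^sup>2 / t)"
      by (intro set_integral_add sq pos)
    have [measurable]: "(\<lambda>t. indicator {0<..} t * g (t * a)) \<in> borel_measurable lebesgue"
      "(\<lambda>t. indicator {0<..} t * g (t * b)) \<in> borel_measurable lebesgue"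
      using dilated_kernel_measurable[OF nonneg int] pos by auto
    have [measurable]: "(\<lambda>t::real. t) \<in> borel_measurable lebesgue"
      by (rule measurable_completion) simp
    have "(\<lambda>t. (indicator {0<..} t * g (t * a)) * (indicator {0<..} t * g (t * b)) / t)
        \<in> borel_measurable lebesgue"
      by measurable
    also have "(\<lambda>t. (indicator {0<..} t * g (t * a)) * (indicator {0<..} t * g (t * b)) / t)
        = (\<lambda>t. indicator {0<..} t *\<^sub>R (g (t * a) * g (t * b) / t))"
      by (auto simp: fun_eq_iff indicator_def)
    finally show "set_borel_measurable lebesgue {0<..} (\<lambda>t. g (t * a) * g (t * b) / t)"
      by (simp add: set_borel_measurable_def)
    have "norm (g (t * a) * g (t * b) / t) \<le> norm ((g (t * a))\<^sup>2 / t + (g (t * b))\<^sup>2 / t)"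
      if "0 < t" for t
    proof -
      have "0 \<le> g (t * a)" "0 \<le> g (t * b)"
        using nonneg pos that by simp_all
      moreover have "2 * (g (t * a) * g (t * b)) \<le> (g (t * a))\<^sup>2 + (g (t * b))\<^sup>2"
        using sum_squares_bound[of "g (t * a)" "g (t * b)"] by (simp add: mult.assoc)
      ultimately have "g (t * a) * g (t * b) \<le> (g (t * a))\<^sup>2 + (g (t * b))\<^sup>2"
        using mult_nonneg_nonneg[of "g (t * a)" "g (t * b)"] by linarith
      then show ?thesis
        using that \<open>0 \<le> g (t * a)\<close> \<open>0 \<le> g (t * b)\<close>
        by (simp only: add_divide_distrib[symmetric] real_norm_def abs_of_nonneg
            divide_nonneg_pos mult_nonneg_nonneg add_nonneg_nonneg zero_le_power2)
          (simp add: divide_right_mono)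
    qed
    then show "AE t in lebesgue. t \<in> {0<..} \<longrightarrow>
        norm (g (t * a) * g (t * b) / t) \<le> norm ((g (t * a))\<^sup>2 / t + (g (t * b))\<^sup>2 / t)"
      by (intro AE_I2 impI) (simp only: greaterThan_iff)
  qed
qed

lemma set_integral_sum:
  fixes F :: "'i \<Rightarrow> 'a \<Rightarrow> real"
  assumes "\<And>i. i \<in> I \<Longrightarrow> set_integrable M S (F i)"
  shows "set_integrable M S (\<lambda>x. \<Sum>i\<in>I. F i x)"
    and "(LINT x:S|M. \<Sum>i\<in>I. F i x) = (\<Sum>i\<in>I. LINT x:S|M. F i x)"
  using assms unfolding set_integrable_def set_lebesgue_integral_def scaleR_sum_right
  by (auto intro!: Bochner_Integration.integrable_sum Bochner_Integration.integral_sum)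

section \<open>The reconstruction formula\<close>

lemma wavelet_product_expansion:
  fixes X :: "nat \<Rightarrow> real ^ 'n"
  shows "wavelet_coeff X ev g f t n * wavelet X ev g t n $ m / t
    = (\<Sum>l<CARD('n). \<Sum>k<CARD('n).
        (graph_fourier X f l * X k $ m * (X l $ n * X k $ n)) * (g (t * ev l) * g (t * ev k) / t))"
  unfolding wavelet_coeff_eq_wavelet_op wavelet_nth wavelet_op_def
  by (simp add: sum_product sum_divide_distrib mult_ac)

lemma sum_vertices_collapse:
  fixes A :: "real ^ 'n ^ 'n" and c :: "nat \<Rightarrow> nat \<Rightarrow> real"
  assumes "laplacian_eigenbasis A X ev"
  shows "(\<Sum>n\<in>UNIV. \<Sum>l<CARD('n). \<Sum>k<CARD('n). c l k * (X l $ n * X k $ n))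
    = (\<Sum>l<CARD('n). c l l)"
proof -
  have on: "X l \<bullet> X k = (if l = k then 1 else 0)" if "l < CARD('n)" "k < CARD('n)" for l k
    using assms that by (simp add: laplacian_eigenbasis_def)
  have "(\<Sum>n\<in>UNIV. \<Sum>l<CARD('n). \<Sum>k<CARD('n). c l k * (X l $ n * X k $ n))
      = (\<Sum>l<CARD('n). \<Sum>n\<in>UNIV. \<Sum>k<CARD('n). c l k * (X l $ n * X k $ n))"
    by (rule sum.swap)
  also have "\<dots> = (\<Sum>l<CARD('n). \<Sum>k<CARD('n). \<Sum>n\<in>UNIV. c l k * (X l $ n * X k $ n))"
    by (intro sum.cong refl sum.swap)
  also have "\<dots> = (\<Sum>l<CARD('n). \<Sum>k<CARD('n). c l k * (X l \<bullet> X k))"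
    by (simp add: inner_vec_def sum_distrib_left)
  also have "\<dots> = (\<Sum>l<CARD('n). \<Sum>k<CARD('n). if l = k then c l k else 0)"
    by (intro sum.cong refl) (simp add: on)
  also have "\<dots> = (\<Sum>l<CARD('n). c l l)"
    by (intro sum.cong refl) simp
  finally show ?thesis .
qed

theorem lemma5p1:
  fixes A :: "real ^ 'n ^ 'n"
    and X :: "nat \<Rightarrow> real ^ 'n" and ev :: "nat \<Rightarrow> real"
    and g :: "real \<Rightarrow> real"
  assumes "weighted_graph A" and "connected_graph A"
    and "laplacian_eigenbasis A X ev"
    and "sgwt_kernel g"
    and "admissible g" and "admissibility_const g \<noteq> 0"
    and "g 0 = 0"
  shows "\<forall>f :: real ^ 'n.
      (\<forall>m. (\<forall>n. set_integrable lebesgue {0<..}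
                  (\<lambda>t. wavelet_coeff X ev g f t n * wavelet X ev g t n $ m / t)) \<and>
           1 / admissibility_const g *
             (\<Sum>n\<in>UNIV. LINT t:{0<..}|lebesgue.
                wavelet_coeff X ev g f t n * wavelet X ev g t n $ m / t)
           = f_sharp X f $ m) \<and>
      f = f_sharp X f + graph_fourier X f 0 *\<^sub>R X 0"
proof (intro allI conjI)
  fix f :: "real ^ 'n"
  show "f = f_sharp X f + graph_fourier X f 0 *\<^sub>R X 0"
    by (simp add: f_sharp_def graph_fourier_def)
next
  fix f :: "real ^ 'n" and m n :: 'n
  note G = assms(1) and C = assms(2) and B = assms(3) and K = assms(4) and int = assms(5)
  define T where "T l k t = g (t * ev l) * g (t * ev k) / t" for l k t
  define c where "c l k = graph_fourier X f l * X k $ m" for l k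
  have ev_nonneg: "0 \<le> ev l" if "l < CARD('n)" for l
    using laplacian_quadratic_form_nonneg[OF G] eigenvalue_eq_quadratic_form[OF B that] by simp
  have T_int: "set_integrable lebesgue {0<..} (T l k)" if "l < CARD('n)" "k < CARD('n)" for l k
    unfolding T_def[abs_def] using that by (intro cross_term_integrable K int ev_nonneg)
  have expand: "(\<lambda>t. wavelet_coeff X ev g f t j * wavelet X ev g t j $ m / t)
      = (\<lambda>t. \<Sum>l<CARD('n). \<Sum>k<CARD('n). (c l k * (X l $ j * X k $ j)) * T l k t)" for j
    by (simp only: wavelet_product_expansion c_def T_def)
  show "set_integrable lebesgue {0<..}
      (\<lambda>t. wavelet_coeff X ev g f t n * wavelet X ev g t n $ m / t)"
    unfolding expand by (intro set_integral_sum(1) set_integrable_mult_right T_int) auto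
  have integral_expand: "(LINT t:{0<..}|lebesgue. wavelet_coeff X ev g f t j * wavelet X ev g t j $ m / t)
      = (\<Sum>l<CARD('n). \<Sum>k<CARD('n).
          (c l k * (LINT t:{0<..}|lebesgue. T l k t)) * (X l $ j * X k $ j))" for j
  proof -
    have "(LINT t:{0<..}|lebesgue. wavelet_coeff X ev g f t j * wavelet X ev g t j $ m / t)
        = (\<Sum>l<CARD('n). LINT t:{0<..}|lebesgue.
            \<Sum>k<CARD('n). (c l k * (X l $ j * X k $ j)) * T l k t)"
      unfolding expand
      by (intro set_integral_sum set_integrable_mult_right T_int) auto
    also have "\<dots> = (\<Sum>l<CARD('n). \<Sum>k<CARD('n). LINT t:{0<..}|lebesgue.
            (c l k * (X l $ j * X k $ j)) * T l k t)"
      by (intro sum.cong refl set_integral_sum set_integrable_mult_right T_int) auto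
    finally show ?thesis
      by (simp add: mult_ac)
  qed
  have diagonal: "(LINT t:{0<..}|lebesgue. T l l t) = (if l = 0 then 0 else admissibility_const g)"
    if "l < CARD('n)" for l
  proof (cases "l = 0")
    case True
    then show ?thesis
      using first_eigenvalue_zero[OF G B] \<open>g 0 = 0\<close> by (simp add: T_def)
  next
    case False
    have "(LINT t:{0<..}|lebesgue. T l l t) = (LINT x:{0<..}|lebesgue. (g x)\<^sup>2 / x)"
      unfolding T_def power2_eq_square[symmetric]
      using int later_eigenvalues_pos[OF G C B that False]
      by (intro dilation_invariance(2)) (simp_all add: admissible_def)
    then show ?thesis
      using False by (simp add: admissibility_const_def)
  qed
  have "(\<Sum>j\<in>UNIV. LINT t:{0<..}|lebesgue. wavelet_coeff X ev g f t j * wavelet X ev g t j $ m / t)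
      = (\<Sum>l<CARD('n). c l l * (LINT t:{0<..}|lebesgue. T l l t))"
    unfolding integral_expand by (rule sum_vertices_collapse[OF B])
  also have "\<dots> = (\<Sum>l<CARD('n). admissibility_const g * (c l l - (if l = 0 then c l l else 0)))"
    by (intro sum.cong refl) (simp add: diagonal)
  also have "\<dots> = admissibility_const g * ((\<Sum>l<CARD('n). c l l) - c 0 0)"
    by (simp add: sum_distrib_left[symmetric] sum_subtractf)
  also have "(\<Sum>l<CARD('n). c l l) = f $ m"
    using arg_cong[OF eigenbasis_expansion[OF B, of f], of "\<lambda>v. v $ m"] by (simp add: c_def)
  finally show "1 / admissibility_const g *
      (\<Sum>j\<in>UNIV. LINT t:{0<..}|lebesgue. wavelet_coeff X ev g f t j * wavelet X ev g t j $ m / t)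
      = f_sharp X f $ m"
    using assms(6) by (simp add: f_sharp_def c_def graph_fourier_def)
qed

end
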